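(* Let $\mathcal H$ be the Hecke algebra of the complex reflection group $W$ considered over $R$. Suppose that $\mathcal H$ is free as an $R$-module with reduced basis $B=\{\tilde T_{w,B}\mid w\in W\}$, and consider the double coset $\langle s\rangle d\langle s\rangle$, for $s$ one of the standard generators of $W$, of order $m_s=n$. Write $\xi_i$ for $\xi_{s,i}$ (so $\xi_0=1$). If $\langle s\rangle d\langle s\rangle$ is additive with $d$ the unique distinguished (minimal length) element and $B$ satisfies $\tilde T_{s^i}\tilde T_{d,B}\tilde T_{s^j}=\tilde T_{s^ids^j,B}$ for any $1\le i,j\le m_s-1$, then the sum $$\sum_{0\le i,j<n} r_{s^ids^j}\,\tilde T_{s^ids^j,B}$$ with $r_{s^ids^j}\in R$ is in $Z_{\mathcal H}(\tilde T_s)$ if and only if the coefficients satisfy the following: (1) $r_{s^ids^j}=r_{s^jds^i}$ for $0\le i,j\le n-1$; (2) for $1\le i,j\le n-1$: if $i+j<n$ then $$r_{s^ids^j}=r_{ds^{i+j}}+\sum_{k=0}^{i-1}\left(\xi_{i-k}\,r_{ds^{j+k}}-\xi_{j+k+1}\,r_{ds^{i-k-1}}\right),$$ and otherwise $$r_{s^ids^j}=r_{ds^{i+j-n}}+\xi_{i+j-n+1}\,r_{ds^{n-1}}+\sum_{k=0}^{n-j-2}\left(\xi_{i-k}\,r_{ds^{j+k}}-\xi_{j+k+1}\,r_{ds^{i-k-1}}\right)$$ (empty sums being $0$).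
   Context: $W$ is a finite complex reflection group given by a Coxeter-type presentation: a finite generating set $S$ of pseudo-reflections (the standard generators), each $s\in S$ of order $m_s$, with homogeneous (braid) relations together with the order relations $s^{m_s}=1$. The length $l(g)$ of $g\in W$ is the minimal number of generators from $S$ (with positive exponents) needed to write $g$. Let $\xi_{s,i}$ ($s\in S$, $1\le i<m_s$) be algebraically independent indeterminates over $\mathbb Z$, except that $\xi_{s,i}=\xi_{t,i}$ when $s,t$ are conjugate, and put $\xi_{s,0}=1$; let $R=\mathbb Z[\xi_{s,i}]$. The Hecke algebra $\mathcal H$ of $W$ is the $R$-algebra generated by $\{\tilde T_s\mid s\in S\}$ subject to the homogeneous relations of $W$ (with $\tilde T_s$ in place of $s$) and the order relations $\tilde T_s^{m_s}=\sum_{i=0}^{m_s-1}\xi_{s,i}\tilde T_s^{\,i}$. $Z_{\mathcal H}(\tilde T_s)$ is the centralizer of $\tilde T_s$ in $\mathcal H$. For a word $\boldsymbol w=s_{i_1}\cdots s_{i_k}$ in $S$ put $\tilde T_{\boldsymbol w}=\tilde T_{s_{i_1}}\cdots\tilde T_{s_{i_k}}$; in particular $\tilde T_{s^i}=\tilde T_s^{\,i}$. A reduced basis $B$ of $\mathcal H$ is an $R$-basis $\{\tilde T_{w,B}\mid w\in W\}$ where, for each $w\in W$, $\tilde T_{w,B}=\tilde T_{\boldsymbol w}$ for some chosen reduced word $\boldsymbol w$ representing $w$. A double coset $\langle s\rangle d\langle s\rangle$ in $W$ is additive if it contains a minimal length representative $d$ such that $l(s^ids^j)=l(d)+i+j$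 for all $0\le i,j\le m_s-1$; its elements are then the $m_s^2$ distinct elements $s^ids^j$, $0\le i,j<m_s$.
   Formalization: The condition T_{s^i} T_{d,B} T_{s^j} = T_{s^i d s^j,B} is assumed for 0≤i,j≤m_s−1, not only 1≤i,j≤m_s−1; with the printed range the claim fails, e.g. for S_4 generated by (12),(23),(13),(34) with s=(34), d=(23)(12). *)

theory Defs
  imports
    "HOL-Analysis.Analysis"
    "HOL-Algebra.QuotRing"
    "HOL-Algebra.Module"
    "HOL-Algebra.Generated_Groups"
    "HOL-Algebra.Multiplicative_Group"
    "HOL-Library.FuncSet"
    "HOL-Library.Poly_Mapping"
begin

section \<open>Complex reflection groups and their presentations\<close>

type_synonym 'n cmat = "complex^'n^'n"

type_synonym 'n rels = "('n cmat list \<times> 'n cmat list) set"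

definition GL :: "('n::finite) cmat monoid"
  where "GL = \<lparr>carrier = {A. invertible A}, monoid.mult = (**), one = mat 1\<rparr>"

text \<open>An element of finite order whose fixed space is a hyperplane.\<close>

definition pseudo_reflection :: "('n::finite) cmat \<Rightarrow> bool"
  where "pseudo_reflection A \<longleftrightarrow>
    invertible A \<and> (\<exists>m>0. A [^]\<^bsub>GL\<^esub> (m::nat) = \<one>\<^bsub>GL\<^esub>) \<and>
    vec.dim {v. A *v v = v} + 1 = CARD('n)"

definition word_prod :: "('a, 'm) monoid_scheme \<Rightarrow> 'a list \<Rightarrow> 'a"
  where "word_prod G u = foldr (\<lambda>x y. x \<otimes>\<^bsub>G\<^esub> y) u \<one>\<^bsub>G\<^esub>"

text \<open>The congruence on the free monoid generated by a set of relations \<open>u = v\<close>.\<close>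

inductive rel_cong :: "('a list \<times> 'a list) set \<Rightarrow> 'a list \<Rightarrow> 'a list \<Rightarrow> bool"
  for E where
  base: "(u, v) \<in> E \<Longrightarrow> rel_cong E (x @ u @ y) (x @ v @ y)"
| refl: "rel_cong E u u"
| sym: "rel_cong E u v \<Longrightarrow> rel_cong E v u"
| trans: "rel_cong E u v \<Longrightarrow> rel_cong E v w \<Longrightarrow> rel_cong E u w"

definition order_rels :: "('n::finite) cmat set \<Rightarrow> 'n rels"
  where "order_rels S = {(replicate (group.ord GL s) s, []) | s. s \<in> S}"

text \<open>
  \<open>E\<close> is the set of homogeneous relations. Since the order relations make every generator
  invertible, the monoid presented by \<open>E\<close> and the order relations is the group presented by them,
  so that positive words suffice.
\<close>

definition coxeter_type_presentation ::
    "('n::finite) cmat set \<Rightarrow> 'n cmat set \<Rightarrow> 'n rels \<Rightarrow> bool"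
  where "coxeter_type_presentation W S E \<longleftrightarrow>
    finite S \<and> (\<forall>s\<in>S. pseudo_reflection s) \<and> generate GL S = W \<and>
    E \<subseteq> lists S \<times> lists S \<and> (\<forall>(u, v)\<in>E. length u = length v) \<and>
    (\<forall>u\<in>lists S. \<forall>v\<in>lists S.
       word_prod GL u = word_prod GL v \<longleftrightarrow> rel_cong (E \<union> order_rels S) u v)"

definition complex_reflection_group ::
    "('n::finite) cmat set \<Rightarrow> 'n cmat set \<Rightarrow> 'n rels \<Rightarrow> bool"
  where "complex_reflection_group W S E \<longleftrightarrow>
    subgroup W GL \<and> finite W \<and> coxeter_type_presentation W S E"

definition len :: "('n::finite) cmat set \<Rightarrow> 'n cmat \<Rightarrow> nat"
  where "len S w = (LEAST k. \<exists>u\<in>lists S. length u = k \<and> word_prod GL u = w)"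

definition reduced_word :: "('n::finite) cmat set \<Rightarrow> 'n cmat list \<Rightarrow> 'n cmat \<Rightarrow> bool"
  where "reduced_word S u w \<longleftrightarrow> u \<in> lists S \<and> word_prod GL u = w \<and> length u = len S w"

definition conj_class :: "('n::finite) cmat set \<Rightarrow> 'n cmat \<Rightarrow> 'n cmat set"
  where "conj_class W s = {w \<otimes>\<^bsub>GL\<^esub> s \<otimes>\<^bsub>GL\<^esub> inv\<^bsub>GL\<^esub> w | w. w \<in> W}"

definition double_coset :: "('n::finite) cmat \<Rightarrow> 'n cmat \<Rightarrow> 'n cmat set"
  where "double_coset s d =
    {x \<otimes>\<^bsub>GL\<^esub> d \<otimes>\<^bsub>GL\<^esub> y | x y. x \<in> generate GL {s} \<and> y \<in> generate GL {s}}"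

definition dc_elt :: "('n::finite) cmat \<Rightarrow> 'n cmat \<Rightarrow> nat \<Rightarrow> nat \<Rightarrow> 'n cmat"
  where "dc_elt s d i j = (s [^]\<^bsub>GL\<^esub> i) \<otimes>\<^bsub>GL\<^esub> d \<otimes>\<^bsub>GL\<^esub> (s [^]\<^bsub>GL\<^esub> j)"

definition distinguished :: "('n::finite) cmat set \<Rightarrow> 'n cmat set \<Rightarrow> 'n cmat \<Rightarrow> bool"
  where "distinguished S D d \<longleftrightarrow> d \<in> D \<and> (\<forall>x\<in>D. len S d \<le> len S x)"

definition additive_double_coset ::
    "('n::finite) cmat set \<Rightarrow> 'n cmat \<Rightarrow> 'n cmat set \<Rightarrow> bool"
  where "additive_double_coset S s D \<longleftrightarrow>
    (\<exists>d. distinguished S D d \<and>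
       (\<forall>i<group.ord GL s. \<forall>j<group.ord GL s. len S (dc_elt s d i j) = len S d + i + j))"


section \<open>The ring of parameters\<close>

text \<open>
  Polynomials with integer coefficients. The indeterminates are pairs \<open>(C, i)\<close> of a conjugacy
  class and an exponent, so that conjugate generators share their parameters.
\<close>

type_synonym 'n params = "('n cmat set \<times> nat \<Rightarrow>\<^sub>0 nat) \<Rightarrow>\<^sub>0 int"

definition param_vars :: "('n::finite) cmat set \<Rightarrow> 'n cmat set \<Rightarrow> ('n cmat set \<times> nat) set"
  where "param_vars W S = {(conj_class W s, i) | s i. s \<in> S \<and> 1 \<le> i \<and> i < group.ord GL s}"

definition param_ring :: "('n::finite) cmat set \<Rightarrow> 'n cmat set \<Rightarrow> 'n params ring"
  where "param_ring W S =
    \<lparr>carrier = {p. \<forall>m\<in>Poly_Mapping.keys p. Poly_Mapping.keys m \<subseteq> param_vars W S},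
     monoid.mult = (*), one = 1, zero = 0, add = (+)\<rparr>"

definition xi :: "('n::finite) cmat set \<Rightarrow> 'n cmat \<Rightarrow> nat \<Rightarrow> 'n params"
  where "xi W s i =
    (if i = 0 then 1
     else Poly_Mapping.single (Poly_Mapping.single (conj_class W s, i) 1) 1)"


section \<open>The Hecke algebra\<close>

text \<open>
  A copy of the type of lists, made a monoid under concatenation, so that finitely supported
  functions on it multiply as in the free associative algebra.
\<close>

datatype 'a fword = FWord (letters: "'a list")

instantiation fword :: (type) monoid_add
begin

definition zero_fword :: "'a fword"
  where "zero_fword = FWord []"

definition plus_fword :: "'a fword \<Rightarrow> 'a fword \<Rightarrow> 'a fword"
  where "plus_fword u v = FWord (letters u @ letters v)"

instance
  by standard (auto simp: zero_fword_def plus_fword_def)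

end

type_synonym 'n free_elt = "'n cmat fword \<Rightarrow>\<^sub>0 'n params"

definition free_algebra :: "('n::finite) cmat set \<Rightarrow> 'n cmat set \<Rightarrow> 'n free_elt ring"
  where "free_algebra W S =
    \<lparr>carrier = {f. \<forall>u\<in>Poly_Mapping.keys f.
        letters u \<in> lists S \<and> Poly_Mapping.lookup f u \<in> carrier (param_ring W S)},
     monoid.mult = (*), one = 1, zero = 0, add = (+)\<rparr>"

definition word_elt :: "('n::finite) cmat list \<Rightarrow> 'n free_elt"
  where "word_elt u = Poly_Mapping.single (FWord u) 1"

definition scalar_elt :: "('n::finite) params \<Rightarrow> 'n free_elt"
  where "scalar_elt r = Poly_Mapping.single 0 r"

definition hecke_rels ::
    "('n::finite) cmat set \<Rightarrow> 'n cmat set \<Rightarrow> 'n rels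
      \<Rightarrow> 'n free_elt set"
  where "hecke_rels W S E =
    {word_elt u - word_elt v | u v. (u, v) \<in> E} \<union>
    {word_elt (replicate (group.ord GL s) s)
      - (\<Sum>i<group.ord GL s. scalar_elt (xi W s i) * word_elt (replicate i s)) | s. s \<in> S}"

definition hecke_ideal ::
    "('n::finite) cmat set \<Rightarrow> 'n cmat set \<Rightarrow> 'n rels
      \<Rightarrow> 'n free_elt set"
  where "hecke_ideal W S E = Idl\<^bsub>free_algebra W S\<^esub> (hecke_rels W S E)"

definition hecke_class ::
    "('n::finite) cmat set \<Rightarrow> 'n cmat set \<Rightarrow> 'n rels
      \<Rightarrow> 'n free_elt \<Rightarrow> 'n free_elt set"
  where "hecke_class W S E f = hecke_ideal W S E +>\<^bsub>free_algebra W S\<^esub> f"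

text \<open>
  The quotient of the free algebra by the two-sided ideal generated by the relations; scalars act
  through the structure map \<open>R \<rightarrow> H\<close>.
\<close>

definition hecke_algebra ::
    "('n::finite) cmat set \<Rightarrow> 'n cmat set \<Rightarrow> 'n rels
      \<Rightarrow> ('n params, 'n free_elt set) module"
  where "hecke_algebra W S E =
    (let Q = free_algebra W S Quot hecke_ideal W S E in
     \<lparr>carrier = carrier Q, monoid.mult = monoid.mult Q, one = one Q, zero = zero Q, add = add Q,
      smult = (\<lambda>r x. hecke_class W S E (scalar_elt r) \<otimes>\<^bsub>Q\<^esub> x)\<rparr>)"

definition T_gen ::
    "('n::finite) cmat set \<Rightarrow> 'n cmat set \<Rightarrow> 'n rels
      \<Rightarrow> 'n cmat \<Rightarrow> 'n free_elt set"
  where "T_gen W S E s = hecke_class W S E (word_elt [s])"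

definition T_word ::
    "('n::finite) cmat set \<Rightarrow> 'n cmat set \<Rightarrow> 'n rels
      \<Rightarrow> 'n cmat list \<Rightarrow> 'n free_elt set"
  where "T_word W S E u = word_prod (hecke_algebra W S E) (map (T_gen W S E) u)"

definition centralizer :: "('a, 'm) monoid_scheme \<Rightarrow> 'a \<Rightarrow> 'a set"
  where "centralizer G a = {x \<in> carrier G. x \<otimes>\<^bsub>G\<^esub> a = a \<otimes>\<^bsub>G\<^esub> x}"

text \<open>Bases indexed by a finite set \<open>A\<close>.\<close>

definition is_basis ::
    "('r, 'k) ring_scheme \<Rightarrow> ('r, 'b, 'm) module_scheme \<Rightarrow> 'a set \<Rightarrow> ('a \<Rightarrow> 'b) \<Rightarrow> bool"
  where "is_basis R M A b \<longleftrightarrow>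
    b \<in> A \<rightarrow> carrier M \<and>
    (\<forall>x\<in>carrier M. \<exists>!c. c \<in> A \<rightarrow>\<^sub>E carrier R \<and> x = (\<Oplus>\<^bsub>M\<^esub>a\<in>A. c a \<odot>\<^bsub>M\<^esub> b a))"

definition reduced_basis ::
    "('n::finite) cmat set \<Rightarrow> 'n cmat set \<Rightarrow> 'n rels
      \<Rightarrow> ('n cmat \<Rightarrow> 'n free_elt set) \<Rightarrow> bool"
  where "reduced_basis W S E B \<longleftrightarrow>
    is_basis (param_ring W S) (hecke_algebra W S E) W B \<and>
    (\<forall>w\<in>W. \<exists>u. reduced_word S u w \<and> B w = T_word W S E u)"

end

theory Submission
  imports Defs
begin

text \<open>
  Expanding \<open>T\<^sub>s X\<close> and \<open>X T\<^sub>s\<close> for \<open>X = \<Sum> a\<^sub>i\<^sub>j T\<^sub>s\<^sup>i T\<^sub>d T\<^sub>s\<^sup>j\<close> with the order relation of \<open>T\<^sub>s\<close> and comparing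
  coefficients, \<open>X\<close> commutes with \<open>T\<^sub>s\<close> iff
  \<open>a\<^bsub>i-1,j\<^esub> + \<xi>\<^sub>i a\<^bsub>n-1,j\<^esub> = a\<^bsub>i,j-1\<^esub> + \<xi>\<^sub>j a\<^bsub>i,n-1\<^esub>\<close> for all \<open>i, j < n\<close>, out-of-range entries being zero.
  The equations with \<open>i = 0\<close> or \<open>j = 0\<close> determine the last row and column; substituting them into the
  others gives the rule
  \<open>a\<^bsub>i+1,j\<^esub> = a\<^bsub>i,j+1\<^esub> + \<xi>\<^bsub>i+1\<^esub> a\<^bsub>0,j\<^esub> - \<xi>\<^bsub>j+1\<^esub> a\<^bsub>i,0\<^esub>\<close>, which telescopes along antidiagonals: to the
  row \<open>0\<close> when \<open>i + j < n\<close>, and to the column \<open>n - 1\<close> otherwise. Telescoping from the column \<open>0\<close> shows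
  \<open>a\<^bsub>i,0\<^esub> = a\<^bsub>0,i\<^esub>\<close> by induction on \<open>i\<close>; then the correction term is antisymmetric in \<open>i, j\<close>, which
  yields the symmetry of \<open>a\<close>. By additivity the elements \<open>s\<^sup>i d s\<^sup>j\<close> are distinct: an equality
  between two of them, with equal lengths \<open>i + j\<close>, gives \<open>s\<^sup>m d s\<^bsup>n-m\<^esup> = d\<close> for some \<open>0 < m < n\<close>.
\<close>

section \<open>The recurrence for the coefficients\<close>

text \<open>Each application of \<open>step\<close> moves one place along an antidiagonal. The
  correction \<open>g\<close> stays arbitrary because it is needed once with entries of column 0 in
  it and once with entries of row 0 only.\<close>

lemma antidiagonal_telescope:
  fixes a :: "nat \<Rightarrow> nat \<Rightarrow> 'a::comm_ring_1"
  assumes step: "\<And>i j. Suc i < n \<Longrightarrow> Suc j < n \<Longrightarrow> a (Suc i) j = a i (Suc j) + g i j"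
    and "i < n" "k \<le> i" "j + k < n"
  shows "a i j = a (i - k) (j + k) + (\<Sum>l<k. g (i - Suc l) (j + l))"
  using assms(3,4)
proof (induction k)
  case (Suc k)
  then have "a (Suc (i - Suc k)) (j + k) = a (i - Suc k) (Suc (j + k)) + g (i - Suc k) (j + k)"
    using \<open>i < n\<close> by (intro step) auto
  moreover have "Suc (i - Suc k) = i - k" using Suc.prems by simp
  ultimately show ?case using Suc by simp
qed simp

text \<open>Elimination first yields a correction with \<open>a i 0\<close>. Here it is written with
  \<open>a 0 i\<close>, so that only row 0 enters, as in the closed formula; this exchange rests on
  the symmetry between row 0 and column 0.\<close>

lemma commutation_recurrence_step_form:
  fixes a :: "nat \<Rightarrow> nat \<Rightarrow> 'a::comm_ring_1"
  assumes x0: "x 0 = 1" and n: "n > 0"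
  shows "(\<forall>i<n. \<forall>j<n.
      (if i = 0 then 0 else a (i - 1) j) + x i * a (n - 1) j =
      (if j = 0 then 0 else a i (j - 1)) + x j * a i (n - 1)) \<longleftrightarrow>
    (\<forall>i<n. \<forall>j<n. a i j = a j i) \<and>
    (\<forall>i. Suc i < n \<longrightarrow> a (Suc i) (n - 1) = a 0 i + x (Suc i) * a 0 (n - 1)) \<and>
    (\<forall>i j. Suc i < n \<longrightarrow> Suc j < n \<longrightarrow>
      a (Suc i) j = a i (Suc j) + (x (Suc i) * a 0 j - x (Suc j) * a 0 i))"
    (is "?comm \<longleftrightarrow> ?sym \<and> ?last \<and> ?step")
proof
  assume comm: ?comm
  define m where "m = n - 1"
  have m: "n = Suc m" using n by (simp add: m_def)
  have corner: "a m 0 = a 0 m"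
    using comm[rule_format, of 0 0] x0 m by simp
  have row: "a m (Suc j) = a 0 j + x (Suc j) * a 0 m" if "Suc j < n" for j
    using comm[rule_format, of 0 "Suc j"] x0 m that by simp
  have col: "a (Suc i) m = a i 0 + x (Suc i) * a m 0" if "Suc i < n" for i
    using comm[rule_format, of "Suc i" 0] x0 m that by simp
  have step0: "a (Suc i) j = a i (Suc j) + (x (Suc i) * a 0 j - x (Suc j) * a i 0)"
    if "Suc i < n" "Suc j < n" for i j
  proof -
    have "a i (Suc j) + x (Suc i) * a m (Suc j) = a (Suc i) j + x (Suc j) * a (Suc i) m"
      using comm[rule_format, of "Suc i" "Suc j"] m that by simp
    then show ?thesis
      unfolding row[OF that(2)] col[OF that(1)] corner by (simp add: algebra_simps)
  qed
  have edge: "a i 0 = a 0 i" if "i < n" for i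
    using that
  proof (induction i rule: less_induct)
    case (less i)
    have "a i 0 = a (i - i) (0 + i) +
        (\<Sum>l<i. x (Suc (i - Suc l)) * a 0 (0 + l) - x (Suc (0 + l)) * a (i - Suc l) 0)"
      using less.prems by (intro antidiagonal_telescope[where n = n] step0) auto
    \<comment> \<open>The induction hypothesis replaces \<open>a 0 l\<close> by \<open>a l 0\<close>
      for \<open>l < i\<close>; reversing the order of summation then makes the two sums
      cancel.\<close>
    also have "\<dots> = a 0 i + ((\<Sum>l<i. x (Suc (i - Suc l)) * a l 0) -
        (\<Sum>l<i. x (Suc l) * a (i - Suc l) 0))"
      using less by (simp add: sum_subtractf)
    also have "(\<Sum>l<i. x (Suc l) * a (i - Suc l) 0) = (\<Sum>l<i. x (Suc (i - Suc l)) * a l 0)"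
      by (subst sum.nat_diff_reindex[symmetric], intro sum.cong) auto
    finally show ?case by simp
  qed
  have step: "a (Suc i) j = a i (Suc j) + (x (Suc i) * a 0 j - x (Suc j) * a 0 i)"
    if "Suc i < n" "Suc j < n" for i j
    using step0[OF that] edge[of i] that by simp
  have last: "a (Suc i) m = a 0 i + x (Suc i) * a 0 m" if "Suc i < n" for i
    using col[OF that] corner edge[of i] that by simp
  have sym: "a i j = a j i" if "i < n" "j < n" for i j
    using that
  proof (induction i arbitrary: j)
    case 0
    then show ?case using edge by simp
  next
    case (Suc i)
    \<comment> \<open>The rule \<open>step\<close> cannot start in the last column, where
      \<open>row\<close> and \<open>last\<close> give both sides directly. Elsewhere one step down,
      the induction hypothesis and one step back with the indices exchanged suffice, the two
      corrections being opposite.\<close>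
    show ?case
    proof (cases "j = m")
      case True
      then show ?thesis using Suc.prems row last by simp
    next
      case False
      then have j: "Suc j < n" using Suc.prems m by simp
      have "a (Suc i) j = a (Suc j) i + (x (Suc i) * a 0 j - x (Suc j) * a 0 i)"
        using step[of i j] Suc j by simp
      also have "\<dots> = a j (Suc i)"
        using step[of j i] Suc.prems j by simp
      finally show ?thesis .
    qed
  qed
  show "?sym \<and> ?last \<and> ?step"
    unfolding m_def[symmetric] using sym last step by blast
next
  assume R: "?sym \<and> ?last \<and> ?step"
  define m where "m = n - 1"
  have m: "n = Suc m" using n by (simp add: m_def)
  have sym: "a i j = a j i" if "i < n" "j < n" for i j using R that by blast
  have last: "a (Suc i) m = a 0 i + x (Suc i) * a 0 m" if "Suc i < n" for i
    using R that unfolding m_def by blast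
  have last': "a m (Suc i) = a 0 i + x (Suc i) * a 0 m" if "Suc i < n" for i
  proof -
    have "a m (Suc i) = a (Suc i) m" by (rule sym) (use that m in auto)
    then show ?thesis using last[OF that] by simp
  qed
  have step: "a (Suc i) j = a i (Suc j) + (x (Suc i) * a 0 j - x (Suc j) * a 0 i)"
    if "Suc i < n" "Suc j < n" for i j using R that by blast
  show ?comm
  proof (intro allI impI)
    fix i j assume ij: "i < n" "j < n"
    show "(if i = 0 then 0 else a (i - 1) j) + x i * a (n - 1) j =
      (if j = 0 then 0 else a i (j - 1)) + x j * a i (n - 1)"
    \<comment> \<open>The four cases are the corner, the last row, the last column, and the step
      rule combined with the values of the last row and column.\<close>
    proof (cases i; cases j)
      assume "i = 0" "j = 0"
      then show ?thesis using sym[of m 0] m by simp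
    next
      fix j' assume "i = 0" "j = Suc j'"
      then show ?thesis using last'[of j'] ij x0 m by simp
    next
      fix i' assume "i = Suc i'" "j = 0"
      then show ?thesis
        using last[of i'] sym[of i' 0] sym[of m 0] ij x0 m by simp
    next
      fix i' j' assume "i = Suc i'" "j = Suc j'"
      then show ?thesis
        using last[of i'] last'[of j'] step[of i' j'] ij m by (simp add: algebra_simps)
    qed
  qed
qed

text \<open>Going forward, the step rule is telescoped to row 0 or to the last column. Going back,
  the formulas at two neighbours on an antidiagonal are subtracted, which recovers a single
  step.\<close>

lemma commutation_recurrence_iff:
  fixes a :: "nat \<Rightarrow> nat \<Rightarrow> 'a::comm_ring_1"
  assumes x0: "x 0 = 1" and n: "n > 0"
  shows "(\<forall>i<n. \<forall>j<n.
      (if i = 0 then 0 else a (i - 1) j) + x i * a (n - 1) j =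
      (if j = 0 then 0 else a i (j - 1)) + x j * a i (n - 1)) \<longleftrightarrow>
    (\<forall>i<n. \<forall>j<n. a i j = a j i) \<and>
    (\<forall>i\<in>{1..<n}. \<forall>j\<in>{1..<n}. a i j =
      (if i + j < n
       then a 0 (i + j)
         + (\<Sum>k\<in>{0..<i}. x (i - k) * a 0 (j + k) - x (j + k + 1) * a 0 (i - k - 1))
       else a 0 (i + j - n) + x (i + j - n + 1) * a 0 (n - 1)
         + (\<Sum>k\<in>{0..<n - j - 1}. x (i - k) * a 0 (j + k) - x (j + k + 1) * a 0 (i - k - 1))))"
    (is "?comm \<longleftrightarrow> ?sym \<and> ?formula")
  unfolding commutation_recurrence_step_form[of x n a, OF assms]
proof (rule conj_cong[OF HOL.refl], rule iffI)
  assume R: "(\<forall>i. Suc i < n \<longrightarrow> a (Suc i) (n - 1) = a 0 i + x (Suc i) * a 0 (n - 1)) \<and>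
    (\<forall>i j. Suc i < n \<longrightarrow> Suc j < n \<longrightarrow>
      a (Suc i) j = a i (Suc j) + (x (Suc i) * a 0 j - x (Suc j) * a 0 i))"
  have tele: "a i j = a (i - k) (j + k) +
      (\<Sum>l\<in>{0..<k}. x (i - l) * a 0 (j + l) - x (j + l + 1) * a 0 (i - l - 1))"
    if "i < n" "k \<le> i" "j + k < n" for i j k
  proof -
    have "a i j = a (i - k) (j + k) + (\<Sum>l<k. x (Suc (i - Suc l)) * a 0 (j + l) -
        x (Suc (j + l)) * a 0 (i - Suc l))"
      using that R by (intro antidiagonal_telescope[where n = n]) blast+
    also have "(\<Sum>l<k. x (Suc (i - Suc l)) * a 0 (j + l) - x (Suc (j + l)) * a 0 (i - Suc l)) =
        (\<Sum>l\<in>{0..<k}. x (i - l) * a 0 (j + l) - x (j + l + 1) * a 0 (i - l - 1))"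
      using that by (intro sum.cong) (auto simp: Suc_diff_Suc)
    finally show ?thesis .
  qed
  show ?formula
  proof (intro ballI)
    fix i j assume ij: "i \<in> {1..<n}" "j \<in> {1..<n}"
    show "a i j = (if i + j < n
       then a 0 (i + j)
         + (\<Sum>k\<in>{0..<i}. x (i - k) * a 0 (j + k) - x (j + k + 1) * a 0 (i - k - 1))
       else a 0 (i + j - n) + x (i + j - n + 1) * a 0 (n - 1)
         + (\<Sum>k\<in>{0..<n - j - 1}. x (i - k) * a 0 (j + k) - x (j + k + 1) * a 0 (i - k - 1)))"
    proof (cases "i + j < n")
      case True
      then show ?thesis using tele[of i i j] ij by (simp add: add.commute)
    next
      case False
      \<comment> \<open>Exactly \<open>n - j - 1\<close> steps lead from column \<open>j\<close> to
        column \<open>n - 1\<close>; the row reached is still positive, so the last-column equation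
        applies there.\<close>
      then have "i - (n - j - 1) = Suc (i + j - n)" "j + (n - j - 1) = n - 1" using ij by auto
      moreover have "a (Suc (i + j - n)) (n - 1) = a 0 (i + j - n) + x (Suc (i + j - n)) * a 0 (n - 1)"
        using R ij by auto
      ultimately show ?thesis using tele[of i "n - j - 1" j] ij False by simp
    qed
  qed
next
  assume sym: ?sym and F: ?formula
  have low: "a i j = a 0 (i + j)
      + (\<Sum>k\<in>{0..<i}. x (i - k) * a 0 (j + k) - x (j + k + 1) * a 0 (i - k - 1))"
    if "1 \<le> i" "1 \<le> j" "i + j < n" for i j
    using F[rule_format, of i j] that by simp
  \<comment> \<open>Both indices are positive here automatically, since \<open>n \<le> i + j\<close>
    while each index is below \<open>n\<close>.\<close>
  have high: "a i j = a 0 (i + j - n) + x (i + j - n + 1) * a 0 (n - 1)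
      + (\<Sum>k\<in>{0..<n - j - 1}. x (i - k) * a 0 (j + k) - x (j + k + 1) * a 0 (i - k - 1))"
    if "i < n" "j < n" "n \<le> i + j" for i j
    using F[rule_format, of i j] that by simp
  have last: "a (Suc i) (n - 1) = a 0 i + x (Suc i) * a 0 (n - 1)" if "Suc i < n" for i
  proof -
    \<comment> \<open>In column \<open>n - 1\<close> the sum in \<open>high\<close> is empty, so the
      formula is already the required equation.\<close>
    have "Suc i + (n - 1) - n = i" using that by simp
    then show ?thesis using high[of "Suc i" "n - 1"] that by simp
  qed
  have step: "a (Suc i) j = a i (Suc j) + (x (Suc i) * a 0 j - x (Suc j) * a 0 i)"
    if ij: "Suc i < n" "Suc j < n" for i j
  \<comment> \<open>The formula speaks of positive indices only, so steps that touch row 0 or column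
    0 are obtained from row 1 and the symmetry.\<close>
  proof (cases "i = 0 \<or> j = 0")
    case True
    have one: "a (Suc 0) l = a 0 (Suc l) + (x (Suc 0) * a 0 l - x (Suc l) * a 0 0)"
      if "Suc l < n" for l
      using low[of 1 l] that sym by (cases "l = 0") auto
    from True show ?thesis
    proof
      assume "j = 0"
      have "a (Suc i) 0 = a 0 (Suc i)" "a i (Suc 0) = a (Suc 0) i" using sym ij by auto
      then show ?thesis using one[of i] ij \<open>j = 0\<close> by simp
    qed (use one ij in simp)
  next
    case False
    show ?thesis
    \<comment> \<open>The places \<open>(Suc i, j)\<close> and \<open>(i, Suc j)\<close> have the
      same index sum and hence fall under the same branch. Their sums differ, after a shift of
      \<open>k\<close>, by the term \<open>k = 0\<close>, which is the correction.\<close>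
    proof (cases "Suc (i + j) < n")
      case True
      show ?thesis
        using False True low[of "Suc i" j] low[of i "Suc j"]
        by (simp add: sum.atLeast0_lessThan_Suc_shift algebra_simps del: sum.op_ivl_Suc)
    next
      case h: False
      have "n - j - 1 = Suc (n - Suc j - 1)" using ij by simp
      then show ?thesis
        using False h ij high[of "Suc i" j] high[of i "Suc j"]
        by (simp add: sum.atLeast0_lessThan_Suc_shift algebra_simps del: sum.op_ivl_Suc)
    qed
  qed
  show "(\<forall>i. Suc i < n \<longrightarrow> a (Suc i) (n - 1) = a 0 i + x (Suc i) * a 0 (n - 1)) \<and>
    (\<forall>i j. Suc i < n \<longrightarrow> Suc j < n \<longrightarrow>
      a (Suc i) j = a i (Suc j) + (x (Suc i) * a 0 j - x (Suc j) * a 0 i))"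
    using last step by blast
qed

section \<open>Scalars, words and double cosets\<close>

text \<open>An abstract form of the embedding of the parameters into the free algebra. Products are
  computed there exactly, and the order relation is divided out afterwards.\<close>

locale scalar_map =
  fixes sc :: "'r::comm_ring_1 \<Rightarrow> 'a::ring_1"
  assumes add: "sc (a + b) = sc a + sc b" and mult: "sc (a * b) = sc a * sc b"
    and zero: "sc 0 = 0" and central: "sc a * f = f * sc a"

text \<open>Multiplication by \<open>t\<close> shifts the coefficients; the overflowing power
  \<open>t ^ n\<close> is traded for lower powers, at the cost of an explicit multiple of the order
  relation.\<close>

lemma (in scalar_map) power_shift_expansion:
  assumes n: "n > 0"
  shows "(\<Sum>i<n. sc (q i) * t ^ i) * t =
    (\<Sum>i<n. sc ((if i = 0 then 0 else q (i - 1)) + x i * q (n - 1)) * t ^ i) +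
    sc (q (n - 1)) * (t ^ n - (\<Sum>i<n. sc (x i) * t ^ i))"
proof -
  obtain m where m: "n = Suc m" using n by (cases n) auto
  have "(\<Sum>i<n. sc (q i) * t ^ i) * t = (\<Sum>i<Suc m. sc (q i) * t ^ Suc i)"
    unfolding m sum_distrib_right by (intro sum.cong) (simp_all add: mult.assoc power_commutes)
  also have "\<dots> = (\<Sum>i<m. sc (q i) * t ^ Suc i) + sc (q m) * t ^ n"
    by (simp add: m)
  also have "(\<Sum>i<m. sc (q i) * t ^ Suc i) = (\<Sum>i<n. sc (if i = 0 then 0 else q (i - 1)) * t ^ i)"
    unfolding m sum.lessThan_Suc_shift by (simp add: zero)
  finally show ?thesis
    by (simp add: m add mult mult.commute[of "x _"] distrib_right sum.distrib right_diff_distrib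
        sum_distrib_left mult.assoc del: sum.lessThan_Suc)
qed

text \<open>For fixed \<open>j\<close> the left factor is a polynomial in \<open>t\<close> with
  central coefficients, so \<open>t\<close> can be moved to its right and the one-variable expansion
  applies.\<close>

lemma (in scalar_map) left_mult_expansion:
  assumes n: "n > 0"
  shows "t * (\<Sum>i<n. \<Sum>j<n. sc (p i j) * (t ^ i * u * t ^ j)) =
    (\<Sum>i<n. \<Sum>j<n. sc ((if i = 0 then 0 else p (i - 1) j) + x i * p (n - 1) j) * (t ^ i * u * t ^ j)) +
    (\<Sum>j<n. sc (p (n - 1) j) * (t ^ n - (\<Sum>i<n. sc (x i) * t ^ i)) * (u * t ^ j))"
proof -
  have factor: "(\<Sum>i<n. \<Sum>j<n. sc (p i j) * (t ^ i * u * t ^ j)) =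
      (\<Sum>j<n. (\<Sum>i<n. sc (p i j) * t ^ i) * (u * t ^ j))" for p
    by (subst sum.swap) (simp add: sum_distrib_right mult.assoc)
  have "t * (sc c * t ^ i) = sc c * t ^ i * t" for c i
    by (metis central mult.assoc power_commutes)
  then have comm: "t * (\<Sum>i<n. sc (p i j) * t ^ i) = (\<Sum>i<n. sc (p i j) * t ^ i) * t" for j
    by (simp add: sum_distrib_left sum_distrib_right)
  have "t * (\<Sum>i<n. \<Sum>j<n. sc (p i j) * (t ^ i * u * t ^ j)) =
      (\<Sum>j<n. t * ((\<Sum>i<n. sc (p i j) * t ^ i) * (u * t ^ j)))"
    unfolding factor by (rule sum_distrib_left)
  also have "\<dots> = (\<Sum>j<n. (\<Sum>i<n. sc (p i j) * t ^ i) * t * (u * t ^ j))"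
    by (simp only: comm flip: mult.assoc)
  finally have "t * (\<Sum>i<n. \<Sum>j<n. sc (p i j) * (t ^ i * u * t ^ j)) = \<dots>" .
  then show ?thesis
    unfolding factor power_shift_expansion[OF n, where x = x]
    by (simp add: distrib_right sum.distrib)
qed

text \<open>The scalars are moved past \<open>t ^ i * u\<close>, which leaves for each
  \<open>i\<close> a polynomial in \<open>t\<close> on the right.\<close>

lemma (in scalar_map) right_mult_expansion:
  assumes n: "n > 0"
  shows "(\<Sum>i<n. \<Sum>j<n. sc (p i j) * (t ^ i * u * t ^ j)) * t =
    (\<Sum>i<n. \<Sum>j<n. sc ((if j = 0 then 0 else p i (j - 1)) + x j * p i (n - 1)) * (t ^ i * u * t ^ j)) +
    (\<Sum>i<n. t ^ i * u * (sc (p i (n - 1)) * (t ^ n - (\<Sum>i<n. sc (x i) * t ^ i))))"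
proof -
  have "sc (p i j) * (t ^ i * u * t ^ j) = t ^ i * u * (sc (p i j) * t ^ j)" for p i j
    using central[of "p i j" "t ^ i * u"] by (simp flip: mult.assoc)
  then have factor: "(\<Sum>i<n. \<Sum>j<n. sc (p i j) * (t ^ i * u * t ^ j)) =
      (\<Sum>i<n. t ^ i * u * (\<Sum>j<n. sc (p i j) * t ^ j))" for p
    by (simp add: sum_distrib_left)
  have "(\<Sum>i<n. \<Sum>j<n. sc (p i j) * (t ^ i * u * t ^ j)) * t =
      (\<Sum>i<n. t ^ i * u * ((\<Sum>j<n. sc (p i j) * t ^ j) * t))"
    unfolding factor by (subst sum_distrib_right) (simp only: mult.assoc)
  then show ?thesis
    unfolding factor power_shift_expansion[OF n, where x = x]
    by (simp add: distrib_left sum.distrib)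
qed

section \<open>Elements of the free algebra as finitely supported functions\<close>

lemma poly_mapping_sum_single:
  "f = (\<Sum>k\<in>Poly_Mapping.keys f. Poly_Mapping.single k (Poly_Mapping.lookup f k))"
  by (rule poly_mapping_eqI)
    (simp add: lookup_sum lookup_single when_def sum.delta in_keys_iff)

text \<open>The exponents need not commute, but 0 is neutral on both sides, so only coefficients
  have to be exchanged.\<close>

lemma single_zero_central:
  fixes f :: "'a::monoid_add \<Rightarrow>\<^sub>0 'b::comm_ring_1"
  shows "Poly_Mapping.single 0 c * f = f * Poly_Mapping.single 0 c"
  by (subst (1 2) poly_mapping_sum_single[of f])
    (simp add: sum_distrib_left sum_distrib_right mult_single mult.commute)

lemma scalar_map_scalar_elt: "scalar_map (scalar_elt :: 'n::finite params \<Rightarrow> 'n free_elt)"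
  unfolding scalar_elt_def
  by standard (simp_all add: single_add mult_single single_zero_central)

lemma word_elt_append: "word_elt (u @ v) = word_elt u * word_elt v"
  by (simp add: word_elt_def mult_single plus_fword_def)

lemma word_elt_Nil [simp]: "word_elt [] = 1"
  by (simp add: word_elt_def flip: zero_fword_def)

lemma word_elt_replicate: "word_elt (replicate k s) = word_elt [s] ^ k"
proof (induction k)
  case (Suc k)
  then show ?case using word_elt_append[of "[s]" "replicate k s"] by simp
qed simp

section \<open>Distinctness of the elements of a double coset\<close>

lemma group_GL: "group (GL :: ('n::finite) cmat monoid)"
proof (rule groupI)
  fix A :: "'n cmat" assume "A \<in> carrier GL"
  then show "\<exists>B\<in>carrier GL. B \<otimes>\<^bsub>GL\<^esub> A = \<one>\<^bsub>GL\<^esub>"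
    by (auto simp: GL_def invertible_def)
qed (auto simp: GL_def invertible_mult matrix_mul_assoc, auto simp: invertible_def)

lemma (in group) inj_on_double_coset:
  fixes l :: "'a \<Rightarrow> nat"
  assumes s: "s \<in> carrier G" and d: "d \<in> carrier G" and n: "s [^] n = \<one>"
    and l: "\<And>i j. i < n \<Longrightarrow> j < n \<Longrightarrow> l (s [^] i \<otimes> d \<otimes> s [^] j) = l d + i + j"
  shows "inj_on (\<lambda>(i, j). s [^] i \<otimes> d \<otimes> s [^] j) ({..<n} \<times> {..<n})"
proof -
  have *: "i = k \<and> j = k'"
    if ij: "i < n" "j < n" "k < n" "k' < n" "k \<le> i"
      and eq: "s [^] i \<otimes> d \<otimes> s [^] j = s [^] k \<otimes> d \<otimes> s [^] k'" for i j k k' :: nat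
  proof -
    have sum: "i + j = k + k'" using l[of i j] l[of k k'] ij eq by simp
    define m where "m = i - k"
    have m: "i = k + m" "k' = m + j" using sum ij by (auto simp: m_def)
    have "s [^] k \<otimes> (s [^] m \<otimes> d \<otimes> s [^] j) = s [^] k \<otimes> (d \<otimes> s [^] m \<otimes> s [^] j)"
      using eq s d by (simp add: m m_assoc nat_pow_mult[symmetric])
    then have comm: "s [^] m \<otimes> d = d \<otimes> s [^] m"
      using s d by simp
    have "m = 0"
    proof (rule ccontr)
      \<comment> \<open>As \<open>s [^] m\<close> commutes with \<open>d\<close>, the element below
        is \<open>d\<close> itself; but \<open>m\<close> and \<open>n - m\<close> are both below
        \<open>n\<close>, so additivity gives it length \<open>l d + n\<close>.\<close>
      assume "m \<noteq> 0"
      have "s [^] m \<otimes> d \<otimes> s [^] (n - m) = d \<otimes> (s [^] m \<otimes> s [^] (n - m))"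
        using comm s d by (simp add: m_assoc)
      also have "\<dots> = d" using s d n m ij by (simp add: nat_pow_mult)
      finally show False using l[of m "n - m"] m ij \<open>m \<noteq> 0\<close> by simp
    qed
    then show ?thesis using m by simp
  qed
  have "i = k \<and> j = k'"
    if "i < n" "j < n" "k < n" "k' < n" "s [^] i \<otimes> d \<otimes> s [^] j = s [^] k \<otimes> d \<otimes> s [^] k'"
    for i j k k' :: nat
    using *[of i j k k'] *[of k k' i j] that by (cases "k \<le> i") auto
  then show ?thesis by (auto simp: inj_on_def)
qed

text \<open>Uniqueness in \<open>is_basis\<close> concerns families on all of \<open>A\<close>;
  families on \<open>K\<close> are compared by carrying them along \<open>e\<close> and extending by
  zero.\<close>

lemma is_basis_coeffs_unique:
  fixes R (structure) and M (structure)
  assumes "abelian_monoid M" and basis: "is_basis R M A b" and fin: "finite A"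
    and zero: "\<zero>\<^bsub>R\<^esub> \<in> carrier R"
    and zero_smult: "\<And>x. x \<in> carrier M \<Longrightarrow> \<zero>\<^bsub>R\<^esub> \<odot>\<^bsub>M\<^esub> x = \<zero>\<^bsub>M\<^esub>"
    and smult_closed: "\<And>c x. c \<in> carrier R \<Longrightarrow> x \<in> carrier M \<Longrightarrow> c \<odot>\<^bsub>M\<^esub> x \<in> carrier M"
    and e: "inj_on e K" "e ` K \<subseteq> A"
    and pq: "p \<in> K \<rightarrow> carrier R" "q \<in> K \<rightarrow> carrier R"
    and eq: "(\<Oplus>\<^bsub>M\<^esub>k\<in>K. p k \<odot>\<^bsub>M\<^esub> b (e k)) = (\<Oplus>\<^bsub>M\<^esub>k\<in>K. q k \<odot>\<^bsub>M\<^esub> b (e k))"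
    and k: "k \<in> K"
  shows "p k = q k"
proof -
  interpret abelian_monoid M by fact
  \<comment> \<open>The restriction to \<open>A\<close> places \<open>ext p\<close> in the
    extensional function space over which \<open>is_basis\<close> quantifies.\<close>
  define ext where "ext p = (\<lambda>w\<in>A. if w \<in> e ` K then p (inv_into K e w) else \<zero>\<^bsub>R\<^esub>)" for p
  have b: "b \<in> A \<rightarrow> carrier M" using basis by (simp add: is_basis_def)
  have ext_closed: "ext p \<in> A \<rightarrow>\<^sub>E carrier R" if "p \<in> K \<rightarrow> carrier R" for p
  proof -
    have "p (inv_into K e w) \<in> carrier R" if "w \<in> e ` K" for w
      using funcset_mem[OF \<open>p \<in> K \<rightarrow> carrier R\<close> inv_into_into[OF that]] .
    then show ?thesis using zero by (auto simp: ext_def)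
  qed
  have ext_e: "ext p (e k) = p k" if "k \<in> K" for p k
    using that e by (auto simp: ext_def inv_into_f_f[OF e(1)])
  have ext_sum: "(\<Oplus>\<^bsub>M\<^esub>w\<in>A. ext p w \<odot>\<^bsub>M\<^esub> b w) = (\<Oplus>\<^bsub>M\<^esub>k\<in>K. p k \<odot>\<^bsub>M\<^esub> b (e k))"
    if p: "p \<in> K \<rightarrow> carrier R" for p
  proof -
    have closed: "(\<lambda>w. ext p w \<odot>\<^bsub>M\<^esub> b w) \<in> A \<rightarrow> carrier M"
      using ext_closed[OF p] b by (auto intro!: smult_closed)
    have "(\<Oplus>\<^bsub>M\<^esub>w\<in>A. ext p w \<odot>\<^bsub>M\<^esub> b w) = (\<Oplus>\<^bsub>M\<^esub>w\<in>e ` K. ext p w \<odot>\<^bsub>M\<^esub> b w)"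
      using closed b e(2) fin
      by (intro add.finprod_mono_neutral_cong_right) (auto simp: ext_def intro!: zero_smult)
    also have "\<dots> = (\<Oplus>\<^bsub>M\<^esub>k\<in>K. ext p (e k) \<odot>\<^bsub>M\<^esub> b (e k))"
      using closed e by (intro finsum_reindex) auto
    also have "\<dots> = (\<Oplus>\<^bsub>M\<^esub>k\<in>K. p k \<odot>\<^bsub>M\<^esub> b (e k))"
      using p b e(2) by (intro finsum_cong') (auto simp: ext_e intro!: smult_closed)
    finally show ?thesis .
  qed
  let ?x = "\<Oplus>\<^bsub>M\<^esub>k\<in>K. p k \<odot>\<^bsub>M\<^esub> b (e k)"
  have "?x \<in> carrier M"
    using pq b e(2) by (intro finsum_closed) (auto intro!: smult_closed)
  then have "\<exists>!c. c \<in> A \<rightarrow>\<^sub>E carrier R \<and> ?x = (\<Oplus>\<^bsub>M\<^esub>a\<in>A. c a \<odot>\<^bsub>M\<^esub> b a)"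
    using basis by (simp add: is_basis_def)
  then obtain c where uniq:
    "\<And>c'. c' \<in> A \<rightarrow>\<^sub>E carrier R \<and> ?x = (\<Oplus>\<^bsub>M\<^esub>a\<in>A. c' a \<odot>\<^bsub>M\<^esub> b a) \<Longrightarrow> c' = c"
    by (elim ex1E) blast
  have "ext p = c"
    by (rule uniq) (simp add: ext_sum[OF pq(1)] ext_closed[OF pq(1)])
  moreover have "ext q = c"
    by (rule uniq) (simp add: ext_sum[OF pq(2)] ext_closed[OF pq(2)] eq)
  ultimately have "ext p = ext q" by simp
  then show ?thesis using ext_e[OF k] by metis
qed

section \<open>The Hecke algebra as a quotient\<close>

context
  fixes W S :: "('n::finite) cmat set"
begin

section \<open>Closure properties of the parameter ring and the free algebra\<close>

lemma
  shows param_ring_zero: "0 \<in> carrier (param_ring W S)"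
    and param_ring_one: "1 \<in> carrier (param_ring W S)"
    and param_ring_add: "p \<in> carrier (param_ring W S) \<Longrightarrow> q \<in> carrier (param_ring W S) \<Longrightarrow>
      p + q \<in> carrier (param_ring W S)"
    and param_ring_mult: "p \<in> carrier (param_ring W S) \<Longrightarrow> q \<in> carrier (param_ring W S) \<Longrightarrow>
      p * q \<in> carrier (param_ring W S)"
    and param_ring_uminus: "p \<in> carrier (param_ring W S) \<Longrightarrow> - p \<in> carrier (param_ring W S)"
proof -
  show "p * q \<in> carrier (param_ring W S)"
    if "p \<in> carrier (param_ring W S)" "q \<in> carrier (param_ring W S)"
    using that keys_mult[of p q] unfolding param_ring_def
    by (fastforce dest: subsetD[OF keys_add])
qed (use keys_add[of p q] in \<open>auto simp: param_ring_def in_keys_iff\<close>)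

lemma xi_closed:
  assumes "s \<in> S" "i < group.ord GL s"
  shows "xi W s i \<in> carrier (param_ring W S)"
proof (cases "i = 0")
  case False
  then have "(conj_class W s, i) \<in> param_vars W S"
    using assms by (auto simp: param_vars_def)
  then show ?thesis using False by (simp add: xi_def param_ring_def)
qed (simp add: xi_def param_ring_one)

lemma free_algebra_simps [simp]:
  "monoid.mult (free_algebra W S) = (*)" "one (free_algebra W S) = 1"
  "zero (free_algebra W S) = 0" "add (free_algebra W S) = (+)"
  by (simp_all add: free_algebra_def)

lemma free_algebra_single:
  "letters u \<in> lists S \<Longrightarrow> c \<in> carrier (param_ring W S) \<Longrightarrow>
    Poly_Mapping.single u c \<in> carrier (free_algebra W S)"
  by (simp add: free_algebra_def lookup_single)

lemma free_algebra_lookup: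
  "f \<in> carrier (free_algebra W S) \<Longrightarrow> Poly_Mapping.lookup f u \<in> carrier (param_ring W S)"
  by (cases "u \<in> Poly_Mapping.keys f") (auto simp: free_algebra_def in_keys_iff param_ring_zero)

lemma free_algebra_add:
  "f \<in> carrier (free_algebra W S) \<Longrightarrow> g \<in> carrier (free_algebra W S) \<Longrightarrow>
    f + g \<in> carrier (free_algebra W S)"
  using keys_add[of f g] param_ring_add[OF free_algebra_lookup free_algebra_lookup, of f g]
  by (auto simp: free_algebra_def lookup_add)

lemma free_algebra_zero: "0 \<in> carrier (free_algebra W S)"
  by (simp add: free_algebra_def)

lemma free_algebra_sum:
  "(\<And>a. a \<in> A \<Longrightarrow> f a \<in> carrier (free_algebra W S)) \<Longrightarrow> sum f A \<in> carrier (free_algebra W S)"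
  by (induction A rule: infinite_finite_induct) (auto simp: free_algebra_zero free_algebra_add)

lemma free_algebra_uminus:
  "f \<in> carrier (free_algebra W S) \<Longrightarrow> - f \<in> carrier (free_algebra W S)"
  by (simp add: free_algebra_def param_ring_uminus in_keys_iff)

lemma free_algebra_diff:
  "f \<in> carrier (free_algebra W S) \<Longrightarrow> g \<in> carrier (free_algebra W S) \<Longrightarrow>
    f - g \<in> carrier (free_algebra W S)"
  using free_algebra_add[OF _ free_algebra_uminus] by fastforce

text \<open>Expanding both factors into monomials reduces closure to concatenation of words and
  products of coefficients.\<close>

lemma free_algebra_mult:
  assumes "f \<in> carrier (free_algebra W S)" "g \<in> carrier (free_algebra W S)"
  shows "f * g \<in> carrier (free_algebra W S)"
proof -
  have "f * g = (\<Sum>k\<in>Poly_Mapping.keys f. \<Sum>l\<in>Poly_Mapping.keys g.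
      Poly_Mapping.single (k + l) (Poly_Mapping.lookup f k * Poly_Mapping.lookup g l))"
    by (subst poly_mapping_sum_single[of f], subst poly_mapping_sum_single[of g])
      (simp add: sum_product mult_single)
  also have "\<dots> \<in> carrier (free_algebra W S)"
    using assms
    by (intro free_algebra_sum free_algebra_single param_ring_mult)
      (auto simp: free_algebra_def plus_fword_def)
  finally show ?thesis .
qed

lemma word_elt_closed: "u \<in> lists S \<Longrightarrow> word_elt u \<in> carrier (free_algebra W S)"
  unfolding word_elt_def by (intro free_algebra_single) (auto simp: param_ring_one)

lemma scalar_elt_closed:
  "c \<in> carrier (param_ring W S) \<Longrightarrow> scalar_elt c \<in> carrier (free_algebra W S)"
  unfolding scalar_elt_def by (intro free_algebra_single) (auto simp: zero_fword_def)

lemma ring_free_algebra: "ring (free_algebra W S)"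
proof (rule ringI)
  show "abelian_group (free_algebra W S)"
    by (rule abelian_groupI)
      (auto simp: free_algebra_add free_algebra_zero add.assoc add.commute
        intro!: bexI[of _ "- _"] free_algebra_uminus)
  show "monoid (free_algebra W S)"
    using word_elt_closed[of "[]"]
    by (intro monoidI) (auto simp: free_algebra_mult mult.assoc)
qed (auto simp: distrib_left distrib_right)

section \<open>The quotient map onto the Hecke algebra\<close>

lemma hecke_algebra_simps:
  "carrier (hecke_algebra W S E) = carrier (free_algebra W S Quot hecke_ideal W S E)"
  "monoid.mult (hecke_algebra W S E) = monoid.mult (free_algebra W S Quot hecke_ideal W S E)"
  "one (hecke_algebra W S E) = one (free_algebra W S Quot hecke_ideal W S E)"
  "zero (hecke_algebra W S E) = zero (free_algebra W S Quot hecke_ideal W S E)"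
  "add (hecke_algebra W S E) = add (free_algebra W S Quot hecke_ideal W S E)"
  "c \<odot>\<^bsub>hecke_algebra W S E\<^esub> x =
    hecke_class W S E (scalar_elt c) \<otimes>\<^bsub>hecke_algebra W S E\<^esub> x"
  by (simp_all add: hecke_algebra_def Let_def)

context
  fixes E :: "'n rels"
  assumes E: "E \<subseteq> lists S \<times> lists S"
begin

lemma hecke_rels_closed: "hecke_rels W S E \<subseteq> carrier (free_algebra W S)"
  using E unfolding hecke_rels_def
  by (auto intro!: free_algebra_diff free_algebra_sum free_algebra_mult word_elt_closed
      scalar_elt_closed xi_closed)

lemma ideal_hecke_ideal: "ideal (hecke_ideal W S E) (free_algebra W S)"
  unfolding hecke_ideal_def by (rule ring.genideal_ideal[OF ring_free_algebra hecke_rels_closed])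

text \<open>The Hecke algebra is a module record with the ring operations of the quotient copied
  into it, so the ring axioms are transferred one by one.\<close>

lemma hecke_class_hom: "ring_hom_ring (free_algebra W S) (hecke_algebra W S E) (hecke_class W S E)"
proof -
  interpret ideal "hecke_ideal W S E" "free_algebra W S" by (rule ideal_hecke_ideal)
  interpret Q: ring "free_algebra W S Quot hecke_ideal W S E" by (rule quotient_is_ring)
  have "ring (hecke_algebra W S E)"
  proof (rule ringI)
    show "abelian_group (hecke_algebra W S E)"
      by (rule abelian_groupI; unfold hecke_algebra_simps(1-5))
        (fact Q.add.m_closed Q.zero_closed Q.a_assoc Q.a_comm Q.l_zero | metis Q.l_neg Q.a_inv_closed)+
    show "monoid (hecke_algebra W S E)"
      by (rule monoidI; unfold hecke_algebra_simps(1-5))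
        (fact Q.m_closed Q.one_closed Q.m_assoc Q.l_one Q.r_one)+
  qed (unfold hecke_algebra_simps(1-5), (fact Q.l_distr Q.r_distr)+)
  moreover have "hecke_class W S E \<in> ring_hom (free_algebra W S) (hecke_algebra W S E)"
    using rcos_ring_hom unfolding ring_hom_def hecke_class_def by (simp add: hecke_algebra_simps)
  ultimately show ?thesis using ring_free_algebra by (intro ring_hom_ringI2)
qed

text \<open>The element is one of the generators of the ideal, written with powers in place of
  constant words; this makes the error terms of the expansions vanish.\<close>

lemma hecke_class_order_relation:
  assumes "s \<in> S" and n: "n = group.ord GL s"
  shows "hecke_class W S E (word_elt [s] ^ n - (\<Sum>i<n. scalar_elt (xi W s i) * word_elt [s] ^ i)) =
      \<zero>\<^bsub>hecke_algebra W S E\<^esub>"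
    (is "hecke_class W S E ?rel = _")
proof -
  interpret ideal "hecke_ideal W S E" "free_algebra W S" by (rule ideal_hecke_ideal)
  have "?rel \<in> hecke_rels W S E"
    unfolding hecke_rels_def using assms by (auto simp flip: word_elt_replicate)
  then have "?rel \<in> hecke_ideal W S E"
    unfolding hecke_ideal_def using ring.genideal_self[OF ring_free_algebra hecke_rels_closed] by blast
  then show ?thesis
    unfolding hecke_class_def hecke_algebra_simps FactRing_def by (simp add: a_rcos_const)
qed

lemma T_word_eq_hecke_class:
  assumes "u \<in> lists S"
  shows "T_word W S E u = hecke_class W S E (word_elt u)"
proof -
  interpret ring_hom_ring "free_algebra W S" "hecke_algebra W S E" "hecke_class W S E"
    by (rule hecke_class_hom)
  from assms show ?thesis
  proof (induction u)
    case Nil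
    then show ?case using hom_one by (simp add: T_word_def word_prod_def)
  next
    case (Cons a u)
    then show ?case
      using hom_mult[OF word_elt_closed[of "[a]"] word_elt_closed[of u]] word_elt_append[of "[a]" u]
      by (simp add: T_word_def word_prod_def T_gen_def)
  qed
qed

lemma hecke_class_sum:
  assumes "\<And>a. a \<in> A \<Longrightarrow> f a \<in> carrier (free_algebra W S)"
  shows "hecke_class W S E (\<Sum>a\<in>A. f a) = (\<Oplus>\<^bsub>hecke_algebra W S E\<^esub>a\<in>A. hecke_class W S E (f a))"
proof -
  interpret ring_hom_ring "free_algebra W S" "hecke_algebra W S E" "hecke_class W S E"
    by (rule hecke_class_hom)
  from assms show ?thesis
  proof (induction A rule: infinite_finite_induct)
    case (insert x A)
    then have "hecke_class W S E (f x + (\<Sum>a\<in>A. f a)) =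
        hecke_class W S E (f x) \<oplus>\<^bsub>hecke_algebra W S E\<^esub> hecke_class W S E (\<Sum>a\<in>A. f a)"
      using hom_add[of "f x" "\<Sum>a\<in>A. f a"] free_algebra_sum[of A f] by simp
    then show ?case using insert by (auto simp: Pi_def)
  qed (use hom_zero in auto)
qed

lemma hecke_class_smult:
  assumes "c \<in> carrier (param_ring W S)" "f \<in> carrier (free_algebra W S)"
  shows "c \<odot>\<^bsub>hecke_algebra W S E\<^esub> hecke_class W S E f = hecke_class W S E (scalar_elt c * f)"
proof -
  interpret ring_hom_ring "free_algebra W S" "hecke_algebra W S E" "hecke_class W S E"
    by (rule hecke_class_hom)
  show ?thesis
    using hom_mult[OF scalar_elt_closed[OF assms(1)] assms(2)] by (simp add: hecke_algebra_simps(6))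
qed

end

end

section \<open>Centralizing elements supported on an additive double coset\<close>

theorem theorem2p4:
  fixes W S :: "('n::finite) cmat set"
    and E :: "'n rels"
    and B :: "'n cmat \<Rightarrow> 'n free_elt set"
    and s d :: "'n cmat"
    and n :: nat
    and r :: "'n cmat \<Rightarrow> 'n params"
  assumes "complex_reflection_group W S E"
    and "reduced_basis W S E B"
    and "s \<in> S" and "n = group.ord GL s"
    and "d \<in> W"
    and "additive_double_coset S s (double_coset s d)"
    and "\<forall>x. distinguished S (double_coset s d) x \<longleftrightarrow> x = d"
    and "\<forall>i<n. \<forall>j<n.
      T_word W S E (replicate i s) \<otimes>\<^bsub>hecke_algebra W S E\<^esub> B d
        \<otimes>\<^bsub>hecke_algebra W S E\<^esub> T_word W S E (replicate j s) = B (dc_elt s d i j)"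
    and "r \<in> double_coset s d \<rightarrow> carrier (param_ring W S)"
  shows "(\<Oplus>\<^bsub>hecke_algebra W S E\<^esub>i\<in>{..<n}. \<Oplus>\<^bsub>hecke_algebra W S E\<^esub>j\<in>{..<n}.
            r (dc_elt s d i j) \<odot>\<^bsub>hecke_algebra W S E\<^esub> B (dc_elt s d i j))
          \<in> centralizer (hecke_algebra W S E) (T_gen W S E s)
    \<longleftrightarrow>
      (\<forall>i<n. \<forall>j<n. r (dc_elt s d i j) = r (dc_elt s d j i)) \<and>
      (\<forall>i\<in>{1..<n}. \<forall>j\<in>{1..<n}.
        r (dc_elt s d i j) =
          (if i + j < n
           then r (dc_elt s d 0 (i + j))
             + (\<Sum>k\<in>{0..<i}. xi W s (i - k) * r (dc_elt s d 0 (j + k))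
                              - xi W s (j + k + 1) * r (dc_elt s d 0 (i - k - 1)))
           else r (dc_elt s d 0 (i + j - n))
             + xi W s (i + j - n + 1) * r (dc_elt s d 0 (n - 1))
             + (\<Sum>k\<in>{0..<n - j - 1}. xi W s (i - k) * r (dc_elt s d 0 (j + k))
                              - xi W s (j + k + 1) * r (dc_elt s d 0 (i - k - 1)))))"
proof -
  let ?R = "param_ring W S" and ?F = "free_algebra W S" and ?H = "hecke_algebra W S E"
    and ?cls = "hecke_class W S E" and ?dc = "dc_elt s d"
  have subW: "subgroup W GL" and finW: "finite W"
    and gen: "generate GL S = W" and E: "E \<subseteq> lists S \<times> lists S"
    and refl: "pseudo_reflection s"
    using assms(1,3) by (auto simp: complex_reflection_group_def coxeter_type_presentation_def)
  have basis: "is_basis ?R ?H W B"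
    and red: "\<And>w. w \<in> W \<Longrightarrow> \<exists>u. reduced_word S u w \<and> B w = T_word W S E u"
    using assms(2) by (auto simp: reduced_basis_def)
  interpret GL: group "GL :: 'n cmat monoid" by (rule group_GL)
  interpret hom: ring_hom_ring ?F ?H ?cls by (rule hecke_class_hom[OF E])
  interpret sc: scalar_map "scalar_elt :: 'n params \<Rightarrow> 'n free_elt" by (rule scalar_map_scalar_elt)

  have sW: "s \<in> W" using gen assms(3) generate.incl[of s S GL] by simp
  have sGL: "s \<in> carrier GL" and dGL: "d \<in> carrier GL"
    using subW sW assms(5) by (auto dest: subgroup.mem_carrier)
  \<comment> \<open>Pseudo-reflections have finite order, whereas \<open>group.ord\<close> is 0 for
    elements of infinite order.\<close>
  have "n > 0"
    using refl GL.pow_eq_id[OF sGL] assms(4) by (auto simp: pseudo_reflection_def intro!: Nat.gr0I)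
  have dc_W: "?dc i j \<in> W" for i j
  proof -
    have "s [^]\<^bsub>GL\<^esub> k \<in> W" for k :: nat
      using GL.subgroup_int_pow_closed[OF subW sW, of "int k"] by (simp add: int_pow_int)
    then show ?thesis using subW assms(5) by (simp add: dc_elt_def subgroup.m_closed)
  qed
  have r_closed: "r (?dc i j) \<in> carrier ?R" for i j
  proof -
    have "s [^]\<^bsub>GL\<^esub> k \<in> generate GL {s}" for k :: nat
      by (induction k) (auto intro: generate.intros)
    then have "?dc i j \<in> double_coset s d" by (auto simp: double_coset_def dc_elt_def)
    then show ?thesis using assms(9) by auto
  qed
  have dc_inj: "inj_on (\<lambda>(i, j). ?dc i j) ({..<n} \<times> {..<n})"
    unfolding dc_elt_def
  proof (rule GL.inj_on_double_coset[where l = "len S"])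
    show "s [^]\<^bsub>GL\<^esub> n = \<one>\<^bsub>GL\<^esub>" using GL.pow_ord_eq_1[OF sGL] assms(4) by simp
    \<comment> \<open>Additivity provides some distinguished element with these lengths; uniqueness
      identifies it with \<open>d\<close>.\<close>
    show "len S (s [^]\<^bsub>GL\<^esub> i \<otimes>\<^bsub>GL\<^esub> d \<otimes>\<^bsub>GL\<^esub> s [^]\<^bsub>GL\<^esub> j) = len S d + i + j" if "i < n" "j < n" for i j
      using assms(4,6,7) that by (auto simp: additive_double_coset_def dc_elt_def)
  qed (fact sGL dGL)+

  obtain ud where ud: "ud \<in> lists S" "B d = T_word W S E ud"
    using red[OF assms(5)] by (auto simp: reduced_word_def)
  \<comment> \<open>Lifts to the free algebra of the generator and of \<open>B d\<close>, the latter
    through the reduced word chosen by the basis.\<close>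
  define t u where "t = (word_elt [s] :: 'n free_elt)" and "u = (word_elt ud :: 'n free_elt)"
  have s_lists: "replicate k s \<in> lists S" for k
    using assms(3) by (induction k) auto
  have t_pow: "t ^ i \<in> carrier ?F" for i
    using word_elt_closed[OF s_lists, of i W] by (simp add: t_def word_elt_replicate)
  have u: "u \<in> carrier ?F" using word_elt_closed ud(1) by (simp add: u_def)
  have tut: "t ^ i * u * t ^ j \<in> carrier ?F" for i j
    by (intro free_algebra_mult t_pow u)
  have B_dc: "B (?dc i j) = ?cls (t ^ i * u * t ^ j)" if "i < n" "j < n" for i j
  proof -
    have "T_word W S E (replicate k s) = ?cls (t ^ k)" for k
      using T_word_eq_hecke_class[OF E, of "replicate k s"] s_lists
      by (simp add: t_def word_elt_replicate)
    moreover have "B d = ?cls u"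
      using T_word_eq_hecke_class[OF E ud(1)] ud(2) by (simp add: u_def)
    moreover have "?cls (t ^ i * u * t ^ j) = ?cls (t ^ i) \<otimes>\<^bsub>?H\<^esub> ?cls u \<otimes>\<^bsub>?H\<^esub> ?cls (t ^ j)"
      using hom.hom_mult[OF t_pow u] hom.hom_mult[OF free_algebra_mult[OF t_pow u] t_pow] by simp
    ultimately show ?thesis using assms(8) that by metis
  qed

  \<comment> \<open>A lift of the sum in the theorem with arbitrary coefficients, since the products
    with \<open>t\<close> have the same shape.\<close>
  define X where "X p = (\<Sum>i<n. \<Sum>j<n. scalar_elt (p i j) * (t ^ i * u * t ^ j))" for p
  have term_closed: "scalar_elt c * (t ^ i * u * t ^ j) \<in> carrier ?F" if "c \<in> carrier ?R" for c i j
    using that by (intro free_algebra_mult scalar_elt_closed tut)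
  have X_closed: "X p \<in> carrier ?F" if "\<And>i j. i < n \<Longrightarrow> j < n \<Longrightarrow> p i j \<in> carrier ?R" for p
    unfolding X_def using that by (intro free_algebra_sum term_closed) auto
  have smult_B: "c \<odot>\<^bsub>?H\<^esub> B (?dc i j) = ?cls (scalar_elt c * (t ^ i * u * t ^ j))"
    if "i < n" "j < n" "c \<in> carrier ?R" for c i j
    using hecke_class_smult[OF E that(3) tut[of i j]] that by (simp add: B_dc)
  have cls_X: "?cls (X p) = (\<Oplus>\<^bsub>?H\<^esub>i\<in>{..<n}. \<Oplus>\<^bsub>?H\<^esub>j\<in>{..<n}. p i j \<odot>\<^bsub>?H\<^esub> B (?dc i j))"
    if p: "\<And>i j. i < n \<Longrightarrow> j < n \<Longrightarrow> p i j \<in> carrier ?R" for p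
  proof -
    have "?cls (X p) = (\<Oplus>\<^bsub>?H\<^esub>i\<in>{..<n}. ?cls (\<Sum>j<n. scalar_elt (p i j) * (t ^ i * u * t ^ j)))"
      unfolding X_def using p by (intro hecke_class_sum[OF E] free_algebra_sum term_closed) auto
    also have "\<dots> = (\<Oplus>\<^bsub>?H\<^esub>i\<in>{..<n}. \<Oplus>\<^bsub>?H\<^esub>j\<in>{..<n}. p i j \<odot>\<^bsub>?H\<^esub> B (?dc i j))"
    proof (rule hom.S.finsum_cong'[OF HOL.refl])
      fix i assume i: "i \<in> {..<n}"
      have "(\<Oplus>\<^bsub>?H\<^esub>j\<in>{..<n}. p i j \<odot>\<^bsub>?H\<^esub> B (?dc i j)) =
          (\<Oplus>\<^bsub>?H\<^esub>j\<in>{..<n}. ?cls (scalar_elt (p i j) * (t ^ i * u * t ^ j)))"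
        using i p by (intro hom.S.finsum_cong') (auto simp: smult_B hom.hom_closed term_closed)
      then show "?cls (\<Sum>j<n. scalar_elt (p i j) * (t ^ i * u * t ^ j)) =
          (\<Oplus>\<^bsub>?H\<^esub>j\<in>{..<n}. p i j \<odot>\<^bsub>?H\<^esub> B (?dc i j))"
        using i p by (subst hecke_class_sum[OF E]) (auto intro!: term_closed)
    qed (use p in \<open>auto intro!: hom.S.finsum_closed simp: smult_B hom.hom_closed term_closed\<close>)
    finally show ?thesis .
  qed
  \<comment> \<open>The double sum becomes a single sum over pairs, the form in which uniqueness of
    coefficients is available.\<close>
  have cls_X_pairs: "?cls (X p) =
      (\<Oplus>\<^bsub>?H\<^esub>k\<in>{..<n} \<times> {..<n}. case_prod p k \<odot>\<^bsub>?H\<^esub> B (case_prod ?dc k))"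
    if p: "\<And>i j. i < n \<Longrightarrow> j < n \<Longrightarrow> p i j \<in> carrier ?R" for p
  proof -
    have "X p = (\<Sum>k\<in>{..<n} \<times> {..<n}. case k of (i, j) \<Rightarrow> scalar_elt (p i j) * (t ^ i * u * t ^ j))"
      unfolding X_def by (rule sum.cartesian_product)
    then have "?cls (X p) = (\<Oplus>\<^bsub>?H\<^esub>k\<in>{..<n} \<times> {..<n}.
        ?cls (case k of (i, j) \<Rightarrow> scalar_elt (p i j) * (t ^ i * u * t ^ j)))"
      using p by (simp only:) (intro hecke_class_sum[OF E], auto intro!: term_closed)
    also have "\<dots> = (\<Oplus>\<^bsub>?H\<^esub>k\<in>{..<n} \<times> {..<n}. case_prod p k \<odot>\<^bsub>?H\<^esub> B (case_prod ?dc k))"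
      using p by (intro hom.S.finsum_cong')
        (auto simp: smult_B hom.hom_closed term_closed)
    finally show ?thesis .
  qed
  have cls_X_eq_iff: "?cls (X p) = ?cls (X q) \<longleftrightarrow> (\<forall>i<n. \<forall>j<n. p i j = q i j)"
    if p: "\<And>i j. i < n \<Longrightarrow> j < n \<Longrightarrow> p i j \<in> carrier ?R"
      and q: "\<And>i j. i < n \<Longrightarrow> j < n \<Longrightarrow> q i j \<in> carrier ?R" for p q
  proof
    assume eq: "?cls (X p) = ?cls (X q)"
    have "case_prod p k = case_prod q k" if "k \<in> {..<n} \<times> {..<n}" for k
    proof (rule is_basis_coeffs_unique[where e = "case_prod ?dc" and K = "{..<n} \<times> {..<n}"
          and p = "case_prod p" and q = "case_prod q", OF hom.S.abelian_monoid_axioms basis finW])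
      show "\<zero>\<^bsub>?R\<^esub> \<in> carrier ?R" by (simp add: param_ring_def)
      show "\<zero>\<^bsub>?R\<^esub> \<odot>\<^bsub>?H\<^esub> x = \<zero>\<^bsub>?H\<^esub>" if "x \<in> carrier ?H" for x
        using that hom.hom_zero
        by (simp add: hecke_algebra_simps(6) param_ring_def sc.zero)
      show "c \<odot>\<^bsub>?H\<^esub> x \<in> carrier ?H" if "c \<in> carrier ?R" "x \<in> carrier ?H" for c x
        using that
        by (simp add: hecke_algebra_simps(6) hom.hom_closed scalar_elt_closed)
      show "case_prod ?dc ` ({..<n} \<times> {..<n}) \<subseteq> W" using dc_W by auto
      show "(\<Oplus>\<^bsub>?H\<^esub>k\<in>{..<n} \<times> {..<n}. case_prod p k \<odot>\<^bsub>?H\<^esub> B (case_prod ?dc k)) =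
          (\<Oplus>\<^bsub>?H\<^esub>k\<in>{..<n} \<times> {..<n}. case_prod q k \<odot>\<^bsub>?H\<^esub> B (case_prod ?dc k))"
        using eq by (simp only: cls_X_pairs[OF p] cls_X_pairs[OF q])
    qed (use p q dc_inj that in auto)
    then show "\<forall>i<n. \<forall>j<n. p i j = q i j" by force
  qed (simp add: X_def)

  define rel where "rel = t ^ n - (\<Sum>i<n. scalar_elt (xi W s i) * t ^ i)"
  have rel_closed: "rel \<in> carrier ?F"
    unfolding rel_def using assms(3,4)
    by (intro free_algebra_diff free_algebra_sum free_algebra_mult t_pow scalar_elt_closed xi_closed) auto
  have cls_rel: "?cls rel = \<zero>\<^bsub>?H\<^esub>"
    using hecke_class_order_relation[OF E assms(3,4)] by (simp add: rel_def t_def)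
  have cls_add_rel: "?cls (f + (\<Sum>k<n. a k * rel * b k)) = ?cls f"
    if "f \<in> carrier ?F" and ab: "\<And>k. k < n \<Longrightarrow> a k \<in> carrier ?F \<and> b k \<in> carrier ?F" for f a b
  proof -
    have "?cls (a k * rel * b k) = \<zero>\<^bsub>?H\<^esub>" if "k < n" for k
      using ab[OF that] hom.hom_mult[of "a k" rel] hom.hom_mult[of "a k * rel" "b k"] rel_closed
      by (simp add: cls_rel free_algebra_mult)
    then have "(\<Oplus>\<^bsub>?H\<^esub>k\<in>{..<n}. ?cls (a k * rel * b k)) = (\<Oplus>\<^bsub>?H\<^esub>k\<in>{..<n}. \<zero>\<^bsub>?H\<^esub>)"
      by (intro hom.S.finsum_cong') auto
    moreover have ab_closed: "a k * rel * b k \<in> carrier ?F" if "k < n" for k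
      using ab[OF that] by (intro free_algebra_mult rel_closed) auto
    ultimately have "?cls (\<Sum>k<n. a k * rel * b k) = \<zero>\<^bsub>?H\<^esub>"
      by (subst hecke_class_sum[OF E]) auto
    then show ?thesis
      using hom.hom_add[OF that(1) free_algebra_sum[of "{..<n}" "\<lambda>k. a k * rel * b k"]] ab_closed
        hom.hom_closed[OF that(1)] by simp
  qed

  define a where "a i j = r (?dc i j)" for i j
  have a: "a i j \<in> carrier ?R" for i j using r_closed by (simp add: a_def)
  have xi: "xi W s i \<in> carrier ?R" if "i < n" for i
    using xi_closed[of s S i] assms(3,4) that by simp
  \<comment> \<open>\<open>al\<close> and \<open>ar\<close> are the coefficients after
    multiplication by the generator from the left and from the right.\<close>
  define al where "al i j = (if i = 0 then 0 else a (i - 1) j) + xi W s i * a (n - 1) j" for i j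
  define ar where "ar i j = (if j = 0 then 0 else a i (j - 1)) + xi W s j * a i (n - 1)" for i j
  have al: "al i j \<in> carrier ?R" and ar: "ar i j \<in> carrier ?R" if "i < n" "j < n" for i j
    unfolding al_def ar_def using that
    by (auto intro!: param_ring_add param_ring_mult a xi param_ring_zero)
  have t: "t \<in> carrier ?F" using t_pow[of 1] by simp
  have "?cls t \<otimes>\<^bsub>?H\<^esub> ?cls (X a) = ?cls (t * X a)"
    using hom.hom_mult[OF t X_closed[of a]] a by simp
  also have "t * X a = X al + (\<Sum>j<n. scalar_elt (a (n - 1) j) * rel * (u * t ^ j))"
    unfolding X_def al_def rel_def by (rule sc.left_mult_expansion[OF \<open>n > 0\<close>])
  also have "?cls \<dots> = ?cls (X al)"
    using X_closed al by (intro cls_add_rel conjI free_algebra_mult scalar_elt_closed a u t_pow) auto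
  finally have left: "?cls t \<otimes>\<^bsub>?H\<^esub> ?cls (X a) = ?cls (X al)" .
  have "?cls (X a) \<otimes>\<^bsub>?H\<^esub> ?cls t = ?cls (X a * t)"
    using hom.hom_mult[OF X_closed[of a] t] a by simp
  also have "X a * t = X ar + (\<Sum>i<n. t ^ i * u * (scalar_elt (a i (n - 1)) * rel))"
    unfolding X_def ar_def rel_def by (rule sc.right_mult_expansion[OF \<open>n > 0\<close>])
  \<comment> \<open>The trailing factor 1 brings the error term into the two-sided form of
    \<open>cls_add_rel\<close>.\<close>
  also have "\<dots> = X ar + (\<Sum>i<n. t ^ i * u * scalar_elt (a i (n - 1)) * rel * 1)"
    by (simp add: mult.assoc)
  also have "?cls \<dots> = ?cls (X ar)"
    using X_closed ar t_pow[of 0]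
    by (intro cls_add_rel conjI free_algebra_mult scalar_elt_closed a u t_pow) auto
  finally have right: "?cls (X a) \<otimes>\<^bsub>?H\<^esub> ?cls t = ?cls (X ar)" .

  have sum_eq: "(\<Oplus>\<^bsub>?H\<^esub>i\<in>{..<n}. \<Oplus>\<^bsub>?H\<^esub>j\<in>{..<n}. r (?dc i j) \<odot>\<^bsub>?H\<^esub> B (?dc i j)) = ?cls (X a)"
    using cls_X[of a] a by (simp add: a_def)
  have "?cls (X a) \<in> centralizer ?H (T_gen W S E s) \<longleftrightarrow> ?cls (X ar) = ?cls (X al)"
    using hom.hom_closed[OF X_closed[of a]] a left right
    by (simp add: centralizer_def T_gen_def flip: t_def)
  also have "\<dots> \<longleftrightarrow> (\<forall>i<n. \<forall>j<n. al i j = ar i j)"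
    using cls_X_eq_iff[OF ar al] by auto
  finally show ?thesis
    unfolding sum_eq al_def ar_def
    using commutation_recurrence_iff[of "xi W s" n a] \<open>n > 0\<close> by (simp add: xi_def a_def)
qed

end
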